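(* Let $\mathcal{A}=(A,\vee,\wedge,\odot,\rightarrow,0,1)$ be a left residuated l-groupoid, and define $x':=x\rightarrow 0$ for all $x\in A$. Suppose that $\mathcal{A}$ satisfies antitony, the double negation law, and the identities $$x\odot y=(x\vee y')\wedge y\qquad\text{and}\qquad x\odot(x\vee y)=x$$ for all $x,y\in A$. Then $\mathbf{L}(\mathcal{A})=(A,\vee,\wedge,{}',0,1)$ is an orthomodular lattice.
   Context: A left residuated l-groupoid is an algebra $(A,\vee,\wedge,\odot,\rightarrow,0,1)$ of type $(2,2,2,2,0,0)$ such that for all $x,y,z\in A$: (i) $(A,\vee,\wedge,0,1)$ is a bounded lattice (with least element $0$ and greatest element $1$); (ii) $x\odot 1=1\odot x=x$; (iii) $x\odot y\le z$ if and only if $x\le y\rightarrow z$. (Neither associativity nor commutativity of $\odot$ is assumed.) With $x':=x\rightarrow 0$, it satisfies antitony if $x\le y$ implies $y'\le x'$ for all $x,y\in A$, and the double negation law if $(x')'=x$ for all $x\in A$. An orthomodular lattice is an algebra $(L,\vee,\wedge,{}',0,1)$ of type $(2,2,1,0,0)$ such that for all $x,y\in L$: (i) $(L,\vee,\wedge,0,1)$ is a bounded lattice; (ii) $x\vee x'=1$; (iii) $x\le y$ implies $y'\le x'$; (iv) $(x')'=x$; (v) $x\le y$ implies $y=x\vee(y\wedge x')$. *)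

theory Defs
  imports "HOL-Library.Complemented_Lattices"
begin

unbundle lattice_syntax

locale left_residuated_l_groupoid =
  fixes mult :: "'a::bounded_lattice \<Rightarrow> 'a \<Rightarrow> 'a"  (infixl \<open>\<odot>\<close> 75)
    and imp :: "'a \<Rightarrow> 'a \<Rightarrow> 'a"  (infixr \<open>\<rightarrow>\<close> 60)
  assumes mult_top: "x \<odot> \<top> = x"
    and top_mult: "\<top> \<odot> x = x"
    and residuation: "x \<odot> y \<le> z \<longleftrightarrow> x \<le> y \<rightarrow> z"

definition neg :: "('a::bounded_lattice \<Rightarrow> 'a \<Rightarrow> 'a) \<Rightarrow> 'a \<Rightarrow> 'a" where
  "neg imp x = imp x \<bottom>"

definition antitony :: "('a::bounded_lattice \<Rightarrow> 'a \<Rightarrow> 'a) \<Rightarrow> bool" where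
  "antitony imp \<longleftrightarrow> (\<forall>x y. x \<le> y \<longrightarrow> neg imp y \<le> neg imp x)"

definition double_negation :: "('a::bounded_lattice \<Rightarrow> 'a \<Rightarrow> 'a) \<Rightarrow> bool" where
  "double_negation imp \<longleftrightarrow> (\<forall>x. neg imp (neg imp x) = x)"

text \<open>
  The library class of orthomodular lattices carries a difference operation, required to be
  \<open>x - y = x \<sqinter> - y\<close>, and lists \<open>x \<sqinter> - x = \<bottom>\<close> among its axioms. With the difference
  instantiated accordingly, it agrees with the usual axioms for an orthocomplementation \<open>c\<close>.
\<close>

lemma orthomodular_lattice_iff:
  fixes c :: "'a::bounded_lattice \<Rightarrow> 'a"
  shows "class.orthomodular_lattice (\<lambda>x y. x \<sqinter> c y) c (\<sqinter>) (\<le>) (<) (\<squnion>) \<bottom> \<top> \<longleftrightarrow>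
    (\<forall>x. x \<squnion> c x = \<top>) \<and>
    (\<forall>x y. x \<le> y \<longrightarrow> c y \<le> c x) \<and>
    (\<forall>x. c (c x) = x) \<and>
    (\<forall>x y. x \<le> y \<longrightarrow> y = x \<squnion> (y \<sqinter> c x))"
  (is "?L \<longleftrightarrow> ?R")
proof
  assume ?L
  then interpret L: orthomodular_lattice "\<lambda>x y. x \<sqinter> c y" c "(\<sqinter>)" "(\<le>)" "(<)" "(\<squnion>)" \<bottom> \<top> .
  show ?R
    using L.sup_compl_top L.ortho_antimono L.ortho_involution L.orthomodular
    by (simp add: inf_commute)
next
  assume R: ?R
  have "x \<sqinter> c x = \<bottom>" for x
  proof -
    have "c (x \<sqinter> c x) = \<top>"
      using R by (metis inf_le1 inf_le2 sup.bounded_iff top_unique)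
    then show ?thesis
      using R by (metis bot_least top_greatest bot_unique)
  qed
  with R show ?L
    by unfold_locales (auto simp: inf_commute)
qed

end

theory Submission
  imports Defs
begin

text \<open>
  Antitony and double negation make \<open>'\<close> a dual automorphism of the lattice, so the De Morgan laws
  hold. Residuation applied to \<open>x' \<le> x \<rightarrow> \<bottom>\<close> gives \<open>x' \<odot> x = \<bottom>\<close>; by the first identity this
  product is \<open>x' \<sqinter> x\<close>, so \<open>x'\<close> is a complement of \<open>x\<close>. If \<open>u \<le> v\<close>, the two identities together
  say \<open>u = (u \<squnion> v') \<sqinter> v\<close>; for \<open>u = y'\<close> and \<open>v = x'\<close> this is the De Morgan dual of the
  orthomodular law.
\<close>

lemma neg_inf_of_antitone_involution:
  fixes c :: "'a::lattice \<Rightarrow> 'a"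
  assumes anti: "\<And>x y. x \<le> y \<Longrightarrow> c y \<le> c x"
    and invol: "\<And>x. c (c x) = x"
  shows "c (x \<sqinter> y) = c x \<squnion> c y"
proof (rule antisym)
  have "c (c x \<squnion> c y) \<le> x \<sqinter> y"
    using anti[of "c x" "c x \<squnion> c y"] anti[of "c y" "c x \<squnion> c y"] by (simp add: invol)
  from anti[OF this] show "c (x \<sqinter> y) \<le> c x \<squnion> c y"
    by (simp add: invol)
  show "c x \<squnion> c y \<le> c (x \<sqinter> y)"
    by (simp add: anti)
qed

theorem theorem8:
  fixes mult :: "'a::bounded_lattice \<Rightarrow> 'a \<Rightarrow> 'a"  (infixl \<open>\<odot>\<close> 75)
    and imp :: "'a \<Rightarrow> 'a \<Rightarrow> 'a"
  assumes "left_residuated_l_groupoid (\<odot>) imp"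
    and "antitony imp"
    and "double_negation imp"
    and "\<And>x y. x \<odot> y = (x \<squnion> neg imp y) \<sqinter> y"
    and "\<And>x y. x \<odot> (x \<squnion> y) = x"
  shows "class.orthomodular_lattice (\<lambda>x y. x \<sqinter> neg imp y) (neg imp) (\<sqinter>) (\<le>) (<) (\<squnion>) \<bottom> \<top>"
proof -
  interpret left_residuated_l_groupoid "(\<odot>)" imp by fact
  let ?c = "neg imp"
  have anti: "?c y \<le> ?c x" if "x \<le> y" for x y
    using assms(2) that by (simp add: antitony_def)
  have invol: "?c (?c x) = x" for x
    using assms(3) by (simp add: double_negation_def)
  note de_morgan = neg_inf_of_antitone_involution[of ?c, OF anti invol]
  have neg_bot: "?c \<bottom> = \<top>"
    using anti[of \<bottom> "?c \<top>"] by (simp add: invol top_unique)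
  have excluded_middle: "x \<squnion> ?c x = \<top>" for x
  proof -
    have "?c x \<odot> x \<le> \<bottom>"
      by (simp add: residuation neg_def)
    then have "?c x \<sqinter> x = \<bottom>"
      by (simp add: assms(4) bot_unique)
    then have "?c (?c x \<sqinter> x) = \<top>"
      by (simp add: neg_bot)
    then show ?thesis
      by (simp add: de_morgan invol)
  qed
  have orthomodular: "y = x \<squnion> (y \<sqinter> ?c x)" if "x \<le> y" for x y
  proof -
    have "?c y \<odot> ?c x = ?c y"
      using assms(5)[of "?c y" "?c x"] anti[OF that] by (simp add: sup_absorb2)
    then have "?c y = ?c x \<sqinter> (?c y \<squnion> x)"
      by (simp add: assms(4) invol inf_commute)
    also have "\<dots> = ?c x \<sqinter> ?c (y \<sqinter> ?c x)"
      by (simp add: de_morgan invol)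
    finally have "?c (?c y) = ?c (?c x \<sqinter> ?c (y \<sqinter> ?c x))"
      by simp
    also have "\<dots> = x \<squnion> (y \<sqinter> ?c x)"
      by (simp only: de_morgan[of "?c x" "?c (y \<sqinter> ?c x)"] invol)
    finally show ?thesis
      by (simp only: invol)
  qed
  show ?thesis
    unfolding orthomodular_lattice_iff
    using excluded_middle anti invol orthomodular by blast
qed

end
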